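(* Let $n\ge 4$. Let $(\boldsymbol{u},p)\in C^{1}(\mathbb{R}^{n}\setminus\{0\})$ be a $(-1)$-homogeneous solution of the steady Euler equations $$\iota_{\boldsymbol{u}}du+d\Pi=0,\qquad \operatorname{div}\boldsymbol{u}=0\qquad\text{on }\mathbb{R}^{n}\setminus\{0\},\qquad \Pi=p+\tfrac12|\boldsymbol{u}|^{2}.$$ Then $\boldsymbol{u}$ is geodesible with respect to the flat metric, i.e. $\iota_{\boldsymbol{u}}du=0$ and $\operatorname{div}\boldsymbol u=0$. In particular, $\Pi=0$ and $$\boldsymbol{u}(\boldsymbol{x})=\frac1\rho\,\boldsymbol{v}(\boldsymbol{y}),\qquad p(\boldsymbol{x})=-\frac{1}{2\rho^{2}}|\boldsymbol{v}(\boldsymbol{y})|^{2},\qquad \rho=|\boldsymbol{x}|,\ \boldsymbol{y}=\boldsymbol{x}/|\boldsymbol{x}|\in\mathbb{S}^{n-1},$$ where $\boldsymbol{v}$ is a (tangential) geodesible vector field on $\mathbb{S}^{n-1}$, i.e. $$\iota_{\boldsymbol{v}}dv=0,\qquad \operatorname{div}_{S}\boldsymbol{v}=0 .$$ In particular, if $n=4$, then $\boldsymbol{v}$ is a Beltrami field on $\mathbb{S}^{3}$: there is a scalar function $\lambda=\lambda(\boldsymbol{y})$ on $\mathbb{S}^3$ such that $$\operatorname{curl}_{S}\boldsymbol{v}=\lambda\boldsymbol{v},\qquad \operatorname{div}_{S}\boldsymbol{v}=0 .$$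
   Context: $\mathbb{R}^n\setminus\{0\}$ carries the flat metric and $\mathbb{S}^{n-1}$ its standard round metric. $u=\boldsymbol{u}^{\flat}$ is the one-form dual to the vector field $\boldsymbol{u}$ in the flat metric; $v=\boldsymbol{v}^{\flat}$ is the one-form dual to the tangential vector field $\boldsymbol{v}$ in the metric of $\mathbb{S}^{n-1}$. $d$ is the exterior derivative (on $\mathbb{R}^n\setminus\{0\}$ or on $\mathbb{S}^{n-1}$ accordingly), $\iota$ is contraction, and $\operatorname{div}_S$ is the divergence on $\mathbb{S}^{n-1}$. The first Euler equation is equivalent to $\boldsymbol{u}\cdot\nabla\boldsymbol{u}+\nabla p=0$; $\Pi$ is called the Bernoulli function. For $\alpha\in\mathbb{R}$, $(\boldsymbol{u},p)$ is a $(-\alpha)$-homogeneous solution if it satisfies the Euler equations and $\boldsymbol{u}(\boldsymbol{x})=\lambda^{\alpha}\boldsymbol{u}(\lambda\boldsymbol{x})$, $p(\boldsymbol{x})=\lambda^{2\alpha}p(\lambda\boldsymbol{x})$ for all $\lambda>0$ and $\boldsymbol{x}\neq0$. A divergence-free vector field $\boldsymbol{w}$ with dual one-form $w$ (on $\mathbb{R}^n\setminus\{0\}$ or $\mathbb{S}^{n-1}$) is called geodesible if $\iota_{\boldsymbol{w}}dw=0$; it may have zeros. On $\mathbb{S}^3$ with volume form $\mu_S$, $\operatorname{curl}_S\boldsymbol{v}$ is the vector field defined by $\iota_{\operatorname{curl}_S\boldsymbol{v}}\mu_S=dv$. *)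

theory Defs
  imports "HOL-Analysis.Analysis"
begin

section \<open>Calculus on open subsets of Euclidean space\<close>

definition C1_on :: "'a::real_normed_vector set \<Rightarrow> ('a \<Rightarrow> 'b::real_normed_vector) \<Rightarrow> bool"
  where "C1_on S f \<longleftrightarrow>
    (\<exists>f' :: 'a \<Rightarrow> 'a \<Rightarrow>\<^sub>L 'b.
      (\<forall>x\<in>S. (f has_derivative blinfun_apply (f' x)) (at x)) \<and> continuous_on S f')"

text \<open>A one-form is a function of a base point and a vector, a two-form a function of a base point
  and two vectors, and so on. The same types serve for forms on the unit sphere; there, only base
  points on the sphere and vectors tangent to it are meaningful.\<close>

definition flat :: "('a::real_inner \<Rightarrow> 'a) \<Rightarrow> 'a \<Rightarrow> 'a \<Rightarrow> real"
  where "flat w x a = w x \<bullet> a"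

definition contract :: "('a \<Rightarrow> 'a) \<Rightarrow> ('a \<Rightarrow> 'a \<Rightarrow> 'c) \<Rightarrow> 'a \<Rightarrow> 'c"
  where "contract w \<omega> x = \<omega> x (w x)"

definition d_fun :: "('a::real_normed_vector \<Rightarrow> real) \<Rightarrow> 'a \<Rightarrow> 'a \<Rightarrow> real"
  where "d_fun f x a = frechet_derivative f (at x) a"

text \<open>With \<open>a\<close> and \<open>b\<close> regarded as constant vector fields, this is
  \<open>d\<omega>(a, b) = a(\<omega>(b)) - b(\<omega>(a))\<close>; on coordinate vectors,
  \<open>(d\<omega>)\<^sub>i\<^sub>j = \<partial>\<^sub>i \<omega>\<^sub>j - \<partial>\<^sub>j \<omega>\<^sub>i\<close>.\<close>

definition d_form :: "('a::real_normed_vector \<Rightarrow> 'a \<Rightarrow> real) \<Rightarrow> 'a \<Rightarrow> 'a \<Rightarrow> 'a \<Rightarrow> real"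
  where "d_form \<omega> x a b =
    frechet_derivative (\<lambda>z. \<omega> z b) (at x) a - frechet_derivative (\<lambda>z. \<omega> z a) (at x) b"

definition pullback ::
    "('a::real_normed_vector \<Rightarrow> 'b::real_normed_vector) \<Rightarrow> ('b \<Rightarrow> 'b \<Rightarrow> real) \<Rightarrow> 'a \<Rightarrow> 'a \<Rightarrow> real"
  where "pullback f \<omega> x a = \<omega> (f x) (frechet_derivative f (at x) a)"

definition div_field :: "(real ^ 'n \<Rightarrow> real ^ 'n) \<Rightarrow> real ^ 'n \<Rightarrow> real"
  where "div_field w x = trace (matrix (frechet_derivative w (at x)))"

section \<open>The steady Euler equations\<close>

definition bernoulli :: "('a::real_normed_vector \<Rightarrow> 'a) \<Rightarrow> ('a \<Rightarrow> real) \<Rightarrow> 'a \<Rightarrow> real"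
  where "bernoulli u p x = p x + (norm (u x))\<^sup>2 / 2"

definition steady_euler :: "(real ^ 'n \<Rightarrow> real ^ 'n) \<Rightarrow> (real ^ 'n \<Rightarrow> real) \<Rightarrow> bool"
  where "steady_euler u p \<longleftrightarrow>
    (\<forall>x. x \<noteq> 0 \<longrightarrow>
      (\<forall>a. contract u (d_form (flat u)) x a + d_fun (bernoulli u p) x a = 0) \<and> div_field u x = 0)"

text \<open>The \<open>(-\<alpha>)\<close>-homogeneous solutions on the punctured space; values at the origin are
  irrelevant.\<close>

definition homogeneous_solution ::
    "real \<Rightarrow> (real ^ 'n \<Rightarrow> real ^ 'n) \<Rightarrow> (real ^ 'n \<Rightarrow> real) \<Rightarrow> bool"
  where "homogeneous_solution \<alpha> u p \<longleftrightarrow>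
    steady_euler u p \<and>
    (\<forall>l x. l > 0 \<and> x \<noteq> 0 \<longrightarrow>
      u x = (l powr \<alpha>) *\<^sub>R u (l *\<^sub>R x) \<and> p x = l powr (2 * \<alpha>) * p (l *\<^sub>R x))"

definition geodesible :: "(real ^ 'n \<Rightarrow> real ^ 'n) \<Rightarrow> bool"
  where "geodesible w \<longleftrightarrow>
    (\<forall>x. x \<noteq> 0 \<longrightarrow>
      (\<forall>a. contract w (d_form (flat w)) x a = 0) \<and> div_field w x = 0)"

section \<open>Vector fields and one-forms on the unit sphere\<close>

definition tangential :: "('a::real_inner \<Rightarrow> 'a) \<Rightarrow> bool"
  where "tangential v \<longleftrightarrow> (\<forall>y\<in>sphere 0 1. v y \<bullet> y = 0)"

definition C1_on_sphere :: "('a::real_normed_vector \<Rightarrow> 'b::real_normed_vector) \<Rightarrow> bool"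
  where "C1_on_sphere v \<longleftrightarrow>
    (\<exists>U V. open U \<and> sphere 0 1 \<subseteq> U \<and> C1_on U V \<and> (\<forall>y\<in>sphere 0 1. V y = v y))"

definition radial_proj :: "'a::real_normed_vector \<Rightarrow> 'a"
  where "radial_proj x = x /\<^sub>R norm x"

text \<open>Write \<open>i\<close> for the inclusion of the sphere and \<open>r\<close> for the radial projection onto it, so that
  \<open>r \<circ> i = id\<close>. A form \<open>\<omega>\<close> on the sphere is then \<open>i\<^sup>* (r\<^sup>* \<omega>)\<close>, and since the exterior
  derivative commutes with pullbacks, \<open>d\<omega> = i\<^sup>* (d (r\<^sup>* \<omega>))\<close>. Thus \<open>sphere_d \<omega> y a b\<close> is the exterior
  derivative of \<open>\<omega>\<close> at \<open>y\<close> in the sphere, for \<open>a\<close> and \<open>b\<close> tangent at \<open>y\<close>.\<close>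

definition sphere_d :: "('a::real_normed_vector \<Rightarrow> 'a \<Rightarrow> real) \<Rightarrow> 'a \<Rightarrow> 'a \<Rightarrow> 'a \<Rightarrow> real"
  where "sphere_d \<omega> = d_form (pullback radial_proj \<omega>)"

definition tangent_proj :: "'a::real_inner \<Rightarrow> 'a \<Rightarrow> 'a"
  where "tangent_proj y a = a - (y \<bullet> a) *\<^sub>R y"

text \<open>The Levi-Civita connection of the round metric: the tangential part of the derivative of \<open>v\<close>
  in the tangent direction \<open>a\<close>, the derivative being that of the extension of \<open>v\<close> constant along
  rays.\<close>

definition sphere_cov :: "('a::real_inner \<Rightarrow> 'a) \<Rightarrow> 'a \<Rightarrow> 'a \<Rightarrow> 'a"
  where "sphere_cov v y a = tangent_proj y (frechet_derivative (v \<circ> radial_proj) (at y) a)"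

text \<open>The trace of \<open>a \<mapsto> \<nabla>\<^sub>a v\<close> on the tangent space, computed after extending this endomorphism by
  zero to the normal direction.\<close>

definition sphere_div :: "(real ^ 'n \<Rightarrow> real ^ 'n) \<Rightarrow> real ^ 'n \<Rightarrow> real"
  where "sphere_div v y = trace (matrix (\<lambda>a. sphere_cov v y (tangent_proj y a)))"

text \<open>The musical isomorphism is again given by \<^const>\<open>flat\<close>, since the round metric is the
  restriction of the flat one.\<close>

definition sphere_geodesible :: "(real ^ 'n \<Rightarrow> real ^ 'n) \<Rightarrow> bool"
  where "sphere_geodesible v \<longleftrightarrow>
    (\<forall>y\<in>sphere 0 1.
      (\<forall>a. a \<bullet> y = 0 \<longrightarrow> contract v (sphere_d (flat v)) y a = 0) \<and> sphere_div v y = 0)"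

section \<open>Curl and Beltrami fields on the three-sphere\<close>

text \<open>Let \<open>'n\<close> have four elements. A bijection \<open>e\<close> from \<open>'n\<close> to \<open>{..<4}\<close> numbers the coordinates and
  thereby orients the space: \<open>vol4 e\<close> is the determinant form with value \<open>1\<close> on the standard basis
  listed in the order \<open>e\<close>. The volume form of the sphere is its contraction with the outward
  normal.\<close>

definition vol4 ::
    "('n \<Rightarrow> nat) \<Rightarrow> real ^ 'n \<Rightarrow> real ^ 'n \<Rightarrow> real ^ 'n \<Rightarrow> real ^ 'n \<Rightarrow> real"
  where "vol4 e a b c d = det (\<chi> i. [a, b, c, d] ! e i)"

definition sphere_vol ::
    "('n \<Rightarrow> nat) \<Rightarrow> real ^ 'n \<Rightarrow> real ^ 'n \<Rightarrow> real ^ 'n \<Rightarrow> real ^ 'n \<Rightarrow> real"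
  where "sphere_vol e y a b c = vol4 e y a b c"

text \<open>\<open>is_sphere_curl e v w\<close>: the tangential field \<open>w\<close> is the curl of \<open>v\<close>. It is unique because the
  volume form is nondegenerate on each tangent space.\<close>

definition is_sphere_curl ::
    "('n \<Rightarrow> nat) \<Rightarrow> (real ^ 'n \<Rightarrow> real ^ 'n) \<Rightarrow> (real ^ 'n \<Rightarrow> real ^ 'n) \<Rightarrow> bool"
  where "is_sphere_curl e v w \<longleftrightarrow>
    tangential w \<and>
    (\<forall>y\<in>sphere 0 1. \<forall>a b. a \<bullet> y = 0 \<and> b \<bullet> y = 0 \<longrightarrow>
      contract w (sphere_vol e) y a b = sphere_d (flat v) y a b)"

definition sphere_beltrami :: "('n \<Rightarrow> nat) \<Rightarrow> (real ^ 'n \<Rightarrow> real ^ 'n) \<Rightarrow> bool"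
  where "sphere_beltrami e v \<longleftrightarrow>
    (\<exists>w. is_sphere_curl e v w \<and> (\<exists>l :: real ^ 'n \<Rightarrow> real. \<forall>y\<in>sphere 0 1. w y = l y *\<^sub>R v y)) \<and>
    (\<forall>y\<in>sphere 0 1. sphere_div v y = 0)"

section \<open>The exterior derivative on the sphere and the connection\<close>

lemma radial_proj_has_derivative:
  fixes x :: "'a::real_inner"
  assumes "x \<noteq> 0"
  shows "(radial_proj has_derivative
           (\<lambda>a. tangent_proj (radial_proj x) a /\<^sub>R norm x)) (at x)"
proof -
  have "(radial_proj has_derivative
      (\<lambda>a. inverse (norm x) *\<^sub>R a + (- (inverse (norm x) * (sgn x \<bullet> a) * inverse (norm x))) *\<^sub>R x)) (at x)"
    unfolding radial_proj_def[abs_def]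
    using assms by (auto intro!: derivative_eq_intros has_derivative_norm simp: inner_commute)
  then show ?thesis
    by (rule has_derivative_eq_rhs)
      (auto simp: tangent_proj_def radial_proj_def sgn_div_norm algebra_simps inner_commute)
qed

lemma sphere_d_flat:
  fixes v :: "'a::real_inner \<Rightarrow> 'a"
  assumes y: "y \<in> sphere 0 1" and a: "a \<bullet> y = 0" and b: "b \<bullet> y = 0"
    and v: "(v \<circ> radial_proj) differentiable (at y)"
  shows "sphere_d (flat v) y a b = sphere_cov v y a \<bullet> b - sphere_cov v y b \<bullet> a"
proof -
  define W' where "W' = frechet_derivative (v \<circ> radial_proj) (at y)"
  have W: "((v \<circ> radial_proj) has_derivative W') (at y)"
    using v unfolding W'_def by (simp add: frechet_derivative_works)
  have ny: "norm y = 1" and y0: "y \<noteq> 0" using y by auto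
  have yy: "y \<bullet> y = 1" using ny by (simp add: dot_square_norm)
  have ry: "radial_proj y = y" using ny by (simp add: radial_proj_def)
  have R: "(radial_proj has_derivative (\<lambda>a. tangent_proj y a)) (at y)"
    using radial_proj_has_derivative[OF y0] by (simp add: ry ny)
  have key: "frechet_derivative (\<lambda>z. pullback radial_proj (flat v) z b) (at y) a
      = W' a \<bullet> b - (v y \<bullet> y) * (a \<bullet> b)"
    if a: "a \<bullet> y = 0" and b: "b \<bullet> y = 0" for a b
  proof -
    let ?g = "\<lambda>z. (v \<circ> radial_proj) z \<bullet> ((b - (radial_proj z \<bullet> b) *\<^sub>R radial_proj z) /\<^sub>R norm z)"
    let ?D = "\<lambda>c. (v \<circ> radial_proj) y \<bullet> ((inverse (norm y)) *\<^sub>R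
        (- ((radial_proj y \<bullet> b) *\<^sub>R tangent_proj y c + (tangent_proj y c \<bullet> b) *\<^sub>R radial_proj y))
        + (- (inverse (norm y) * (sgn y \<bullet> c) * inverse (norm y))) *\<^sub>R (b - (radial_proj y \<bullet> b) *\<^sub>R radial_proj y))
      + W' c \<bullet> ((b - (radial_proj y \<bullet> b) *\<^sub>R radial_proj y) /\<^sub>R norm y)"
    let ?h = "\<lambda>z. b - (radial_proj z \<bullet> b) *\<^sub>R radial_proj z"
    have h: "(?h has_derivative (\<lambda>c. - ((radial_proj y \<bullet> b) *\<^sub>R tangent_proj y c
        + (tangent_proj y c \<bullet> b) *\<^sub>R radial_proj y))) (at y)"
      by (auto intro!: derivative_eq_intros R)
    have n: "((\<lambda>z. inverse (norm z)) has_derivative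
        (\<lambda>c. - (inverse (norm y) * (sgn y \<bullet> c) * inverse (norm y)))) (at y)"
      using y0 by (auto intro!: derivative_eq_intros has_derivative_norm simp: inner_commute)
    have g: "(?g has_derivative ?D) (at y)"
      by (rule has_derivative_inner[OF W has_derivative_scaleR[OF n h]])
    have eq: "?g z = pullback radial_proj (flat v) z b" if "z \<in> - {0}" for z
      using that frechet_derivative_at[OF radial_proj_has_derivative[of z], symmetric]
      by (simp add: pullback_def flat_def tangent_proj_def)
    have "((\<lambda>z. pullback radial_proj (flat v) z b) has_derivative ?D) (at y)"
    proof (rule has_derivative_transform_within_open[OF g])
      show "open (- {0 :: 'a})" by (simp add: open_Compl)
      show "y \<in> - {0}" using y0 by simp
    qed (rule eq)
    from frechet_derivative_at[OF this, symmetric]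
    have "frechet_derivative (\<lambda>z. pullback radial_proj (flat v) z b) (at y) a = ?D a" by simp
    also have "\<dots> = W' a \<bullet> b - (v y \<bullet> y) * (a \<bullet> b)"
    proof -
      have "y \<bullet> b = 0" "y \<bullet> a = 0" "sgn y = y"
        using a b ny by (simp_all add: inner_commute[of y] sgn_div_norm)
      then show ?thesis by (simp add: ry ny tangent_proj_def)
    qed
    finally show ?thesis .
  qed
  show ?thesis
    unfolding sphere_d_def d_form_def key[OF a b] key[OF b a]
    using a b by (simp add: sphere_cov_def tangent_proj_def W'_def[symmetric] inner_diff_left inner_commute[of y] inner_commute[of b a])
qed

end

theory Submission
  imports Defs
begin

text \<open>Write \<open>F = x \<bullet> u\<close>, which is homogeneous of degree \<open>0\<close>, and let \<open>T\<close> be the part of \<open>u\<close> tangent to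
  the spheres. Contracting the Euler equation with \<open>x\<close> and with \<open>u\<close> gives \<open>T \<cdot> \<nabla>F = 2 \<Pi>\<close> and
  \<open>T \<cdot> \<nabla>\<Pi> = 2 F \<Pi> / |x|\<^sup>2\<close>, while \<open>div u = 0\<close> becomes \<open>div T = - (n - 2) F / |x|\<^sup>2\<close>. Hence, for
  \<open>g(t) = t |t|\<^bsup>(n-4)/2\<^esup>\<close> and a radial cutoff \<open>\<eta>\<close>, the field \<open>\<eta> F g(\<Pi>) T\<close> has the nonnegative divergence
  \<open>2 \<eta> \<Pi> g(\<Pi>)\<close>; as its integral is zero, \<open>\<Pi> = 0\<close>. Then \<open>\<eta> F T\<close> has the divergence
  \<open>- \<eta> (n - 2) F\<^sup>2 / |x|\<^sup>2\<close>, so \<open>F = 0\<close> and \<open>u\<close> is tangential. If \<open>n = 4\<close>, the two-form \<open>du\<close> on the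
  four-dimensional space is annihilated by \<open>x\<close> and \<open>u\<close>, hence a multiple of the volume form contracted
  with them wherever \<open>u \<noteq> 0\<close>; at the zeros of \<open>u\<close>, it vanishes.\<close>

section \<open>The divergence theorem for compactly supported fields\<close>

lemma integrable_lborel_compact_support:
  fixes f :: "'a::euclidean_space \<Rightarrow> real"
  assumes "compact K" and "continuous_on UNIV f" and "\<And>x. x \<notin> K \<Longrightarrow> f x = 0"
  shows "integrable lborel f"
proof -
  have "integrable lborel (\<lambda>x. indicator K x *\<^sub>R f x)"
    using assms by (intro borel_integrable_compact) (auto intro: continuous_on_subset)
  moreover have "(\<lambda>x. indicator K x *\<^sub>R f x) = f"
    using assms(3) by (auto simp: fun_eq_iff indicator_def)
  ultimately show ?thesis by simp
qed

lemma has_derivative_outside_support: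
  assumes "(f has_derivative f') (at x)" and "closed K" and "\<And>x. x \<notin> K \<Longrightarrow> f x = 0" and "x \<notin> K"
  shows "f' = (\<lambda>a. 0)"
proof -
  have "((\<lambda>x. 0) has_derivative (\<lambda>a. 0)) (at x)" by simp
  then have "(f has_derivative (\<lambda>a. 0)) (at x)"
    by (rule has_derivative_transform_within_open[where s="- K"]) (use assms in auto)
  with assms(1) show ?thesis by (rule has_derivative_unique)
qed

text \<open>Lebesgue measure is translation invariant, so the difference quotients of
  \<open>f\<close> along \<open>e\<close> all integrate to zero; dominated convergence carries this
  over to the derivative.\<close>

lemma integral_directional_derivative_eq_0:
  fixes f :: "'a::euclidean_space \<Rightarrow> real"
  assumes der: "\<And>x. (f has_derivative f' x) (at x)"
    and cont: "continuous_on UNIV (\<lambda>x. f' x e)"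
    and K: "compact K" "\<And>x. x \<notin> K \<Longrightarrow> f x = 0"
  shows "integrable lborel (\<lambda>x. f' x e)" and "integral\<^sup>L lborel (\<lambda>x. f' x e) = 0"
proof -
  have supp: "f' x e = 0" if "x \<notin> K" for x
    using has_derivative_outside_support[OF der compact_imp_closed[OF K(1)] K(2) that] by simp
  show "integrable lborel (\<lambda>x. f' x e)"
    using K(1) cont supp by (rule integrable_lborel_compact_support)
  have "continuous_on UNIV f"
    by (meson der continuous_at_imp_continuous_on has_derivative_continuous)
  have int_f: "integrable lborel f"
    by (rule integrable_lborel_compact_support) fact+
  have shift: "integrable lborel (\<lambda>x. f (c + x))" "integral\<^sup>L lborel (\<lambda>x. f (c + x)) = integral\<^sup>L lborel f" for c
  proof -
    have f: "f \<in> borel_measurable borel" using int_f by simp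
    have "integrable (distr lborel borel ((+) c)) f" using int_f by (simp add: lborel_distr_plus)
    then show "integrable lborel (\<lambda>x. f (c + x))" by (subst (asm) integrable_distr_eq) (use f in auto)
    have "integral\<^sup>L (distr lborel borel ((+) c)) f = integral\<^sup>L lborel (\<lambda>x. f (c + x))"
      by (rule integral_distr) (use f in auto)
    then show "integral\<^sup>L lborel (\<lambda>x. f (c + x)) = integral\<^sup>L lborel f" by (simp add: lborel_distr_plus)
  qed
  have "bounded ((\<lambda>x. f' x e) ` K)"
    using K(1) cont by (meson compact_continuous_image compact_imp_bounded continuous_on_subset subset_UNIV)
  then obtain M where M: "0 < M" "\<And>x. x \<in> K \<Longrightarrow> \<bar>f' x e\<bar> \<le> M"
    by (auto simp: bounded_pos)
  have bound: "\<bar>f' x e\<bar> \<le> M" for x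
    using M supp[of x] by (cases "x \<in> K") auto
  \<comment> \<open>The index shift keeps the steps in \<open>(0, 1]\<close>, so that all
    translations stay within the segment from \<open>0\<close> to \<open>e\<close>.\<close>
  define h where "h k = 1 / real (Suc k)" for k
  have h: "0 < h k" "h k \<le> 1" for k by (auto simp: h_def field_simps)
  have h_lim: "h \<longlonglongrightarrow> 0" unfolding h_def by (rule LIMSEQ_Suc[OF lim_1_over_n])
  \<comment> \<open>If \<open>x\<close> is outside \<open>L\<close>, no \<open>x + t e\<close> with
    \<open>0 \<le> t \<le> 1\<close> lies in \<open>K\<close>, so one compact set carries all the
    quotients \<open>s k\<close>.\<close>
  define L where "L = {x - y | x y. x \<in> K \<and> y \<in> closed_segment 0 e}"
  have "compact L" unfolding L_def using K(1) compact_segment by (rule compact_differences)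
  define s where "s k x = (f (h k *\<^sub>R e + x) - f x) / h k" for k x
  have line: "((\<lambda>t. f (t *\<^sub>R e + x)) has_derivative (\<lambda>d. d * f' (t *\<^sub>R e + x) e)) (at t within S)" for t x S
  proof -
    have "((\<lambda>t. f (t *\<^sub>R e + x)) has_derivative (\<lambda>d. f' (t *\<^sub>R e + x) (d *\<^sub>R e))) (at t within S)"
      by (rule has_derivative_compose[where f="\<lambda>t. t *\<^sub>R e + x", OF _ der]) (auto intro!: derivative_eq_intros)
    then show ?thesis
      by (simp add: linear_scale[OF has_derivative_linear[OF der]])
  qed
  have s_bound: "\<bar>s k x\<bar> \<le> M * indicator L x" for k x
  proof (cases "x \<in> L")
    case True
    have "\<exists>t\<in>{0<..<h k}. f (h k *\<^sub>R e + x) - f (0 *\<^sub>R e + x) = (h k - 0) * f' (t *\<^sub>R e + x) e"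
      by (rule mvt_simple[OF h(1) line])
    then obtain t where "f (h k *\<^sub>R e + x) - f x = h k * f' (t *\<^sub>R e + x) e" by auto
    then have "s k x = f' (t *\<^sub>R e + x) e" using h(1)[of k] by (simp add: s_def)
    with True bound show ?thesis by simp
  next
    case False
    have "x + t *\<^sub>R e \<notin> K" if "0 \<le> t" "t \<le> 1" for t
    proof
      assume "x + t *\<^sub>R e \<in> K"
      moreover have "t *\<^sub>R e \<in> closed_segment 0 e" using that by (auto simp: in_segment)
      ultimately have "(x + t *\<^sub>R e) - t *\<^sub>R e \<in> L" unfolding L_def by blast
      with False show False by simp
    qed
    from this[of 0] this[of "h k"] have "f x = 0" "f (h k *\<^sub>R e + x) = 0"
      using h[of k] K(2) by (auto simp: add.commute)
    then show ?thesis using M by (simp add: s_def)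
  qed
  have "(\<lambda>k. integral\<^sup>L lborel (s k)) \<longlonglongrightarrow> integral\<^sup>L lborel (\<lambda>x. f' x e)"
  proof (rule integral_dominated_convergence[where w="\<lambda>x. M * indicator L x"])
    show "(\<lambda>x. f' x e) \<in> borel_measurable lborel"
      using cont by (simp add: borel_measurable_continuous_onI)
    show "s k \<in> borel_measurable lborel" for k
      unfolding s_def using shift(1)[of "h k *\<^sub>R e"] int_f by measurable
    have "emeasure lborel L < \<infinity>" using \<open>compact L\<close> by (rule emeasure_compact_finite)
    then show "integrable lborel (\<lambda>x. M * indicator L x)"
      using \<open>compact L\<close> by (intro integrable_mult_right integrable_real_indicator) (auto intro: borel_compact)
    show "AE x in lborel. norm (s k x) \<le> M * indicator L x" for k using s_bound by simp
    show "AE x in lborel. (\<lambda>k. s k x) \<longlonglongrightarrow> f' x e"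
    proof (rule AE_I2)
      fix x
      have "((\<lambda>t. f (t *\<^sub>R e + x)) has_real_derivative f' x e) (at 0)"
        using line[of x 0 UNIV] by (simp add: has_field_derivative_def mult_commute_abs)
      then have "((\<lambda>t. (f (t *\<^sub>R e + x) - f x) / t) \<longlongrightarrow> f' x e) (at 0)"
        by (simp add: has_field_derivative_iff)
      moreover have "filterlim h (at 0) sequentially"
        unfolding filterlim_at using h_lim h(1) by (auto simp: less_imp_neq[THEN not_sym] intro!: always_eventually)
      ultimately show "(\<lambda>k. s k x) \<longlonglongrightarrow> f' x e"
        unfolding s_def by (rule filterlim_compose)
    qed
  qed
  moreover have "integral\<^sup>L lborel (s k) = 0" for k
    unfolding s_def using shift[of "h k *\<^sub>R e"] int_f by simp
  ultimately show "integral\<^sup>L lborel (\<lambda>x. f' x e) = 0"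
    using LIMSEQ_unique[OF _ tendsto_const] by simp
qed

lemma integral_divergence_eq_0:
  fixes W :: "'a::euclidean_space \<Rightarrow> 'a"
  assumes der: "\<And>x. (W has_derivative W' x) (at x)"
    and cont: "\<And>a. continuous_on UNIV (\<lambda>x. W' x a)"
    and K: "compact K" "\<And>x. x \<notin> K \<Longrightarrow> W x = 0"
  shows "integrable lborel (\<lambda>x. \<Sum>b\<in>Basis. W' x b \<bullet> b)"
    and "integral\<^sup>L lborel (\<lambda>x. \<Sum>b\<in>Basis. W' x b \<bullet> b) = 0"
proof -
  have *: "integrable lborel (\<lambda>x. W' x b \<bullet> b)" "integral\<^sup>L lborel (\<lambda>x. W' x b \<bullet> b) = 0" for b
  proof -
    have d: "((\<lambda>x. W x \<bullet> b) has_derivative (\<lambda>a. W' x a \<bullet> b)) (at x)" for x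
      by (rule has_derivative_inner_left[OF der])
    have c: "continuous_on UNIV (\<lambda>x. W' x b \<bullet> b)" by (intro continuous_intros cont)
    show "integrable lborel (\<lambda>x. W' x b \<bullet> b)" "integral\<^sup>L lborel (\<lambda>x. W' x b \<bullet> b) = 0"
      using integral_directional_derivative_eq_0[OF d c K(1)] K(2) by auto
  qed
  then show "integrable lborel (\<lambda>x. \<Sum>b\<in>Basis. W' x b \<bullet> b)"
    and "integral\<^sup>L lborel (\<lambda>x. \<Sum>b\<in>Basis. W' x b \<bullet> b) = 0"
    by simp_all
qed

text \<open>The integral is zero, so the nonnegative divergence vanishes almost everywhere; by
  continuity its zero set is closed, and a closed set of full measure is the whole space.\<close>

lemma divergence_nonneg_imp_eq_0:
  fixes W :: "'a::euclidean_space \<Rightarrow> 'a"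
  assumes der: "\<And>x. (W has_derivative W' x) (at x)"
    and cont: "\<And>a. continuous_on UNIV (\<lambda>x. W' x a)"
    and K: "compact K" "\<And>x. x \<notin> K \<Longrightarrow> W x = 0"
    and nonneg: "\<And>x. 0 \<le> (\<Sum>b\<in>Basis. W' x b \<bullet> b)"
  shows "(\<Sum>b\<in>Basis. W' x b \<bullet> b) = 0"
proof -
  let ?f = "\<lambda>x. \<Sum>b\<in>Basis. W' x b \<bullet> b"
  have "continuous_on UNIV ?f" by (intro continuous_intros cont)
  then have closed: "closed {x. ?f x = 0}" by (intro closed_Collect_eq) auto
  have "AE x in lborel. ?f x = 0"
    using integral_nonneg_eq_0_iff_AE[of lborel ?f] integral_divergence_eq_0[OF der cont K] nonneg
    by simp
  then have "AE x in lebesgue. x \<in> UNIV \<longrightarrow> x \<in> {x. ?f x = 0}"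
    by (auto intro: AE_completion)
  from mem_closed_if_AE_lebesgue_open[OF open_UNIV closed this] show ?thesis by simp
qed

section \<open>Cutoff and power functions\<close>

text \<open>The derivative of \<open>\<eta>\<close> is a multiple of \<open>x \<bullet> a\<close>,
  so it vanishes on directions tangent to the spheres. The support in a shell avoids the
  origin.\<close>

lemma obtain_radial_cutoff:
  obtains \<eta> c :: "'a::euclidean_space \<Rightarrow> real"
  where "\<And>x. (\<eta> has_derivative (\<lambda>a. c x * (x \<bullet> a))) (at x)" and "continuous_on UNIV c"
    and "\<And>x. 0 \<le> \<eta> x" and "\<And>x. norm x = 1 \<Longrightarrow> 0 < \<eta> x"
    and "\<And>x. norm x \<le> 1 / 2 \<or> 2 \<le> norm x \<Longrightarrow> \<eta> x = 0 \<and> c x = 0"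
proof
  \<comment> \<open>\<open>q\<close> is positive exactly for \<open>1/2 < |x| < 2\<close>; squaring
    its positive part makes the cutoff continuously differentiable.\<close>
  define q where "q x = (x \<bullet> x - 1 / 4) * (4 - x \<bullet> x)" for x :: 'a
  define \<eta> where "\<eta> x = (max 0 (q x))\<^sup>2" for x
  define c where "c x = 2 * max 0 (q x) * (2 * (4 - x \<bullet> x) - 2 * (x \<bullet> x - 1 / 4))" for x
  have sq: "((\<lambda>t::real. (max 0 t)\<^sup>2) has_real_derivative 2 * max 0 t) (at t)" for t
  proof -
    consider "t > 0" | "t < 0" | "t = 0" by linarith
    then show ?thesis
    proof cases
      case 1
      have "((\<lambda>t::real. t\<^sup>2) has_real_derivative 2 * max 0 t) (at t)"
        using 1 by (auto intro!: derivative_eq_intros)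
      then show ?thesis
        by (rule has_field_derivative_transform_within_open[where S="{0<..}"]) (use 1 in auto)
    next
      case 2
      have "((\<lambda>t::real. 0) has_real_derivative 2 * max 0 t) (at t)"
        using 2 by (auto intro!: derivative_eq_intros)
      then show ?thesis
        by (rule has_field_derivative_transform_within_open[where S="{..<0}"]) (use 2 in auto)
    next
      case 3
      \<comment> \<open>Caratheodory's criterion with slope function \<open>max 0\<close>, as
        \<open>(max 0 t)^2 = max 0 t * t\<close>.\<close>
      show ?thesis unfolding 3 CARAT_DERIV
        by (intro exI[of _ "max 0"] conjI allI continuous_intros) (auto simp: max_def power2_eq_square)
    qed
  qed
  show "(\<eta> has_derivative (\<lambda>a. c x * (x \<bullet> a))) (at x)" for x
  proof -
    have "(q has_derivative (\<lambda>a. (2 * (4 - x \<bullet> x) - 2 * (x \<bullet> x - 1 / 4)) * (x \<bullet> a))) (at x)"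
      unfolding q_def by (auto intro!: derivative_eq_intros simp: algebra_simps inner_commute)
    then show ?thesis
      unfolding \<eta>_def c_def using has_derivative_compose[OF _ sq[unfolded has_field_derivative_def]]
      by (fastforce simp: algebra_simps)
  qed
  show "continuous_on UNIV c" unfolding c_def q_def by (intro continuous_intros)
  show "0 \<le> \<eta> x" for x by (simp add: \<eta>_def)
  show "0 < \<eta> x" if "norm x = 1" for x using that by (simp add: \<eta>_def q_def dot_square_norm)
  show "\<eta> x = 0 \<and> c x = 0" if "norm x \<le> 1 / 2 \<or> 2 \<le> norm x" for x
  proof -
    have "q x \<le> 0"
    proof (cases "norm x \<le> 1 / 2")
      case True
      then have "(norm x)\<^sup>2 \<le> (1 / 2)\<^sup>2" by (intro power_mono) auto
      then show ?thesis unfolding q_def dot_square_norm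
        by (intro mult_nonpos_nonneg) (auto simp: power2_eq_square)
    next
      case False
      with that have "2\<^sup>2 \<le> (norm x)\<^sup>2" by (intro power_mono) auto
      then show ?thesis unfolding q_def dot_square_norm
        by (intro mult_nonneg_nonpos) (auto simp: power2_eq_square)
    qed
    then show ?thesis by (simp add: \<eta>_def c_def)
  qed
qed

text \<open>The function is \<open>t |t|^(k/2)\<close>. The natural power of the root equals
  \<open>1\<close> at \<open>t = 0\<close> when \<open>k = 0\<close>, so the formula covers the
  identity as well.\<close>

lemma has_real_derivative_mult_sqrt_abs_power:
  "((\<lambda>t::real. t * sqrt \<bar>t\<bar> ^ k) has_real_derivative real (k + 2) / 2 * sqrt \<bar>t\<bar> ^ k) (at t)"
proof (cases "t = 0")
  case True
  \<comment> \<open>At \<open>t = 0\<close>, the factor \<open>sqrt |t| ^ k\<close> is itself the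
    Caratheodory slope; its value there is \<open>1\<close> if \<open>k = 0\<close> and
    \<open>0\<close> otherwise, which agrees with the formula.\<close>
  have "sqrt \<bar>0\<bar> ^ k = real (k + 2) / 2 * sqrt \<bar>0\<bar> ^ k" by (cases k) auto
  moreover have "isCont (\<lambda>t::real. sqrt \<bar>t\<bar> ^ k) 0" by (intro continuous_intros)
  ultimately show ?thesis unfolding True CARAT_DERIV
    by (intro exI[of _ "\<lambda>t. sqrt \<bar>t\<bar> ^ k"]) (simp only: diff_0_right mult_zero_left mult.commute simp_thms)
next
  case False
  define s where "s = sgn t"
  have abs: "\<bar>t\<bar> = s * t" "s * t > 0" using False by (auto simp: s_def abs_sgn sgn_if)
  define r where "r = sqrt (s * t)"
  have r: "r > 0" "r * r = s * t" using abs by (auto simp: r_def)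
  have "((\<lambda>t. sqrt (s * t)) has_real_derivative s / (2 * r)) (at t)"
    by (rule DERIV_cong, rule DERIV_chain2[OF DERIV_real_sqrt DERIV_cmult_Id])
      (use abs(2) in \<open>auto simp only: r_def divide_inverse inverse_mult_distrib mult_ac\<close>)
  then have "((\<lambda>t. sqrt (s * t) ^ k) has_real_derivative
      real k * (s / (2 * r) * sqrt (s * t) ^ (k - Suc 0))) (at t)"
    by (rule DERIV_power)
  then have "((\<lambda>t. t * sqrt (s * t) ^ k) has_real_derivative
      1 * sqrt (s * t) ^ k + real k * (s / (2 * r) * sqrt (s * t) ^ (k - Suc 0)) * t) (at t)"
    by (rule DERIV_mult[OF DERIV_ident])
  then have "((\<lambda>t. t * sqrt (s * t) ^ k) has_real_derivative
      r ^ k + t * (real k * (s / (2 * r) * r ^ (k - 1)))) (at t)"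
    by (rule DERIV_cong) (simp only: r_def[symmetric] One_nat_def mult_1_left mult.commute)
  also have "t * (real k * (s / (2 * r) * r ^ (k - 1))) = real k / 2 * ((s * t) / r * r ^ (k - 1))" by simp
  also have "(s * t) / r = r" using r by (simp add: field_simps)
  also have "real k / 2 * (r * r ^ (k - 1)) = real k / 2 * r ^ k"
    by (cases k) auto
  also have "r ^ k + real k / 2 * r ^ k = real (k + 2) / 2 * sqrt \<bar>t\<bar> ^ k"
    by (simp add: abs(1) r_def[symmetric] add_divide_distrib distrib_right)
  finally have *: "((\<lambda>t. t * sqrt (s * t) ^ k) has_real_derivative real (k + 2) / 2 * sqrt \<bar>t\<bar> ^ k) (at t)" .
  show ?thesis
  proof (rule has_field_derivative_transform_within_open[OF *])
    show "open {x. 0 < s * x}" by (intro open_Collect_less continuous_intros)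
    show "t \<in> {x. 0 < s * x}" using abs by simp
    show "x * sqrt (s * x) ^ k = x * sqrt \<bar>x\<bar> ^ k" if "x \<in> {x. 0 < s * x}" for x
      using that by (auto simp: s_def sgn_if zero_less_mult_iff split: if_splits)
  qed
qed

section \<open>Homogeneous solutions of the Euler equations\<close>

lemma trace_matrix: "trace (matrix L) = (\<Sum>b\<in>Basis. L b \<bullet> b)"
  for L :: "real ^ 'n \<Rightarrow> real ^ 'n"
proof -
  have Basis: "Basis = range (\<lambda>i. axis i 1 :: real ^ 'n)"
    by (auto simp: Basis_vec_def)
  have "(\<Sum>b\<in>Basis. L b \<bullet> b) = (\<Sum>i\<in>UNIV. L (axis i 1) \<bullet> axis i 1)"
    unfolding Basis by (subst sum.reindex) (auto simp: inj_def axis_eq_axis)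
  then show ?thesis by (simp add: trace_def matrix_def inner_axis)
qed

lemma has_derivative_bernoulli:
  fixes u :: "'a::real_inner \<Rightarrow> 'a"
  assumes "(u has_derivative u') (at x)" and "(p has_derivative p') (at x)"
  shows "(bernoulli u p has_derivative (\<lambda>a. p' a + u x \<bullet> u' a)) (at x)"
  unfolding bernoulli_def[abs_def] power2_norm_eq_inner
  using assms by (auto intro!: derivative_eq_intros simp: inner_commute)

lemma d_form_flat:
  assumes "(u has_derivative u') (at x)"
  shows "d_form (flat u) x a b = u' a \<bullet> b - u' b \<bullet> a"
proof -
  have "((\<lambda>z. flat u z b) has_derivative (\<lambda>a. u' a \<bullet> b)) (at x)" for b
    unfolding flat_def by (rule has_derivative_inner_left[OF assms])
  from frechet_derivative_at[OF this, symmetric] show ?thesis by (simp add: d_form_def)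
qed

lemma div_field_eq_sum_Basis:
  assumes "(w has_derivative w') (at x)"
  shows "div_field w x = (\<Sum>b\<in>Basis. w' b \<bullet> b)"
  using frechet_derivative_at[OF assms] by (simp add: div_field_def trace_matrix)

lemma sum_Basis_inner_mult_inner: "(\<Sum>b\<in>Basis. (x \<bullet> b) * (b \<bullet> y)) = x \<bullet> y"
  for x y :: "'a::euclidean_space"
  by (simp add: euclidean_inner[of x y] inner_commute[of y])

text \<open>Euler's relation for homogeneous maps: \<open>f' x\<close> is the derivative of
  \<open>f\<close> along the ray through \<open>x\<close> at \<open>l = 1\<close>, where homogeneity
  supplies an explicit \<open>g\<close>.\<close>

lemma has_derivative_eq_by_radial_line:
  assumes f: "(f has_derivative f') (at x)" and x: "x \<noteq> 0"
    and g: "(g has_vector_derivative d) (at 1)" and eq: "\<And>l. 0 < l \<Longrightarrow> f (l *\<^sub>R x) = g l"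
  shows "f' x = d"
proof -
  have "((\<lambda>l. f (l *\<^sub>R x)) has_derivative (\<lambda>l. f' (l *\<^sub>R x))) (at 1)"
    by (rule has_derivative_compose[OF has_derivative_scaleR_left[OF has_derivative_ident]]) (simp add: f)
  then have "(g has_derivative (\<lambda>l. f' (l *\<^sub>R x))) (at 1)"
    by (rule has_derivative_transform_within_open[where s="{0<..}"]) (use eq in auto)
  then have "(\<lambda>l. f' (l *\<^sub>R x)) = (\<lambda>l. l *\<^sub>R d)"
    using g unfolding has_vector_derivative_def by (rule has_derivative_unique)
  from fun_cong[OF this, of 1] show ?thesis by simp
qed

text \<open>The derivatives are parameters, so that those of \<open>P\<close>, \<open>F\<close> and
  \<open>T\<close> can be given by formulas. Continuity is stated for each fixed direction, the form
  that the divergence theorem above takes.\<close>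

locale homogeneous_euler =
  fixes u :: "real ^ 'n \<Rightarrow> real ^ 'n" and p :: "real ^ 'n \<Rightarrow> real"
    and u' :: "real ^ 'n \<Rightarrow> real ^ 'n \<Rightarrow> real ^ 'n" and p' :: "real ^ 'n \<Rightarrow> real ^ 'n \<Rightarrow> real"
  assumes dim: "CARD('n) \<ge> 4"
    and u_der: "x \<noteq> 0 \<Longrightarrow> (u has_derivative u' x) (at x)"
    and u'_cont: "continuous_on (- {0}) (\<lambda>x. u' x a)"
    and p_der: "x \<noteq> 0 \<Longrightarrow> (p has_derivative p' x) (at x)"
    and p'_cont: "continuous_on (- {0}) (\<lambda>x. p' x a)"
    and sol: "homogeneous_solution 1 u p"
begin

abbreviation "P \<equiv> bernoulli u p"

definition P' where "P' x a = p' x a + u x \<bullet> u' x a"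

definition F where "F x = x \<bullet> u x"

definition F' where "F' x a = x \<bullet> u' x a + a \<bullet> u x"

definition T where "T x = u x - (F x / (x \<bullet> x)) *\<^sub>R x"

definition T' where "T' x a = u' x a - (F x / (x \<bullet> x)) *\<^sub>R a
  - ((F' x a * (x \<bullet> x) - F x * (2 * (x \<bullet> a))) / (x \<bullet> x)\<^sup>2) *\<^sub>R x"

lemma P_der: "x \<noteq> 0 \<Longrightarrow> (P has_derivative P' x) (at x)"
  unfolding P'_def[abs_def] by (intro has_derivative_bernoulli u_der p_der)

lemma F_der: "x \<noteq> 0 \<Longrightarrow> (F has_derivative F' x) (at x)"
  unfolding F_def[abs_def] F'_def[abs_def]
  by (auto intro!: derivative_eq_intros u_der)

lemma T_der:
  assumes "x \<noteq> 0" shows "(T has_derivative T' x) (at x)"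
proof -
  have "((\<lambda>x. F x / (x \<bullet> x)) has_derivative
      (\<lambda>a. (F' x a * (x \<bullet> x) - F x * (2 * (x \<bullet> a))) / (x \<bullet> x)\<^sup>2)) (at x)"
    using assms
    by (auto intro!: derivative_eq_intros F_der simp: power2_eq_square inner_commute)
  then have "((\<lambda>x. (F x / (x \<bullet> x)) *\<^sub>R x) has_derivative (\<lambda>a. (F x / (x \<bullet> x)) *\<^sub>R a
      + ((F' x a * (x \<bullet> x) - F x * (2 * (x \<bullet> a))) / (x \<bullet> x)\<^sup>2) *\<^sub>R x)) (at x)"
    by (intro has_derivative_scaleR has_derivative_ident)
  from has_derivative_diff[OF u_der[OF assms] this] show ?thesis
    by (simp add: T_def[abs_def] T'_def[abs_def] diff_diff_eq)
qed

lemma continuous_on_fields: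
  "continuous_on (- {0}) u" "continuous_on (- {0}) P"
  "continuous_on (- {0}) F" "continuous_on (- {0}) T"
  by (auto intro!: continuous_at_imp_continuous_on
      intro: u_der p_der P_der F_der T_der has_derivative_continuous)

lemma P'_cont: "continuous_on (- {0}) (\<lambda>x. P' x a)"
  unfolding P'_def by (intro continuous_intros u'_cont p'_cont continuous_on_fields)

lemma F'_cont: "continuous_on (- {0}) (\<lambda>x. F' x a)"
  unfolding F'_def by (intro continuous_intros u'_cont continuous_on_fields)

lemma T'_cont: "continuous_on (- {0}) (\<lambda>x. T' x a)"
  unfolding T'_def by (intro continuous_intros u'_cont F'_cont continuous_on_fields) auto

section \<open>Homogeneity and Euler's relation\<close>

lemma homogeneous:
  assumes "0 < l" "x \<noteq> 0"
  shows "u (l *\<^sub>R x) = (1 / l) *\<^sub>R u x" and "p (l *\<^sub>R x) = p x / l\<^sup>2"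
proof -
  have "u x = (l powr 1) *\<^sub>R u (l *\<^sub>R x)" "p x = l powr (2 * 1) * p (l *\<^sub>R x)"
    using sol assms unfolding homogeneous_solution_def by blast+
  then have eq: "u x = l *\<^sub>R u (l *\<^sub>R x)" "p x = l\<^sup>2 * p (l *\<^sub>R x)"
    using \<open>0 < l\<close> by simp_all
  show "u (l *\<^sub>R x) = (1 / l) *\<^sub>R u x"
    unfolding eq(1) using \<open>0 < l\<close> by simp
  show "p (l *\<^sub>R x) = p x / l\<^sup>2"
    unfolding eq(2) using \<open>0 < l\<close> by simp
qed

lemma F_homogeneous: "0 < l \<Longrightarrow> x \<noteq> 0 \<Longrightarrow> F (l *\<^sub>R x) = F x"
  by (simp add: F_def homogeneous)

lemma P_homogeneous: "0 < l \<Longrightarrow> x \<noteq> 0 \<Longrightarrow> P (l *\<^sub>R x) = P x / l\<^sup>2"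
  by (simp add: bernoulli_def homogeneous field_simps)

lemma u'_radial: "x \<noteq> 0 \<Longrightarrow> u' x x = - u x"
  by (rule has_derivative_eq_by_radial_line[where g="\<lambda>l. (1 / l) *\<^sub>R u x", OF u_der _ _ homogeneous(1)])
    (auto intro!: derivative_eq_intros simp: has_vector_derivative_def)

lemma F'_radial: "x \<noteq> 0 \<Longrightarrow> F' x x = 0"
  by (simp add: F'_def u'_radial)

lemma P'_radial: "x \<noteq> 0 \<Longrightarrow> P' x x = - 2 * P x"
  by (rule has_derivative_eq_by_radial_line[where g="\<lambda>l. P x / l\<^sup>2", OF P_der _ _ P_homogeneous])
    (auto intro!: derivative_eq_intros simp: has_vector_derivative_def power2_eq_square)

section \<open>Pointwise identities from the Euler equations\<close>

lemma euler: "x \<noteq> 0 \<Longrightarrow> u' x (u x) \<bullet> a - u' x a \<bullet> u x + P' x a = 0"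
  using sol frechet_derivative_at[OF P_der[of x]]
  by (auto simp: homogeneous_solution_def steady_euler_def contract_def d_fun_def d_form_flat[OF u_der])

lemma div_u: "x \<noteq> 0 \<Longrightarrow> (\<Sum>b\<in>Basis. u' x b \<bullet> b) = 0"
  using sol div_field_eq_sum_Basis[OF u_der[of x]]
  by (auto simp: homogeneous_solution_def steady_euler_def)

text \<open>The Euler equation is tested with \<open>x\<close>. Homogeneity turns
  \<open>u' x x\<close> and \<open>P' x x\<close> into \<open>- u x\<close> and
  \<open>- 2 * P x\<close>, and the resulting \<open>|u|^2\<close> completes
  \<open>x \<bullet> u' x (u x)\<close> to \<open>F' x (u x)\<close>.\<close>

lemma F'_u: "x \<noteq> 0 \<Longrightarrow> F' x (u x) = 2 * P x"
  using euler[of x x] by (simp add: F'_def u'_radial P'_radial inner_commute)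

text \<open>Bernoulli's law: tested with \<open>u\<close> itself, the two-form terms cancel by
  antisymmetry.\<close>

lemma P'_u: "x \<noteq> 0 \<Longrightarrow> P' x (u x) = 0"
  using euler[of x "u x"] by simp

text \<open>\<open>T\<close> differs from \<open>u\<close> by a multiple of \<open>x\<close>, and
  \<open>F\<close> is constant along rays.\<close>

lemma F'_T: "x \<noteq> 0 \<Longrightarrow> F' x (T x) = 2 * P x"
  using linear_diff[OF has_derivative_linear[OF F_der]] linear_scale[OF has_derivative_linear[OF F_der]]
  by (simp add: T_def F'_u F'_radial)

text \<open>\<open>P\<close> has zero derivative along \<open>u\<close>, so the radial correction in
  \<open>T\<close> gives the whole value.\<close>

lemma P'_T: "x \<noteq> 0 \<Longrightarrow> P' x (T x) = 2 * F x * P x / (x \<bullet> x)"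
  using linear_diff[OF has_derivative_linear[OF P_der]] linear_scale[OF has_derivative_linear[OF P_der]]
  by (simp add: T_def P'_u P'_radial)

lemma inner_T: "x \<bullet> T x = 0"
  by (simp add: T_def F_def inner_diff_right)

text \<open>As \<open>u\<close> is divergence-free, only the subtracted field
  \<open>(F / |x|^2) x\<close> contributes. For \<open>f\<close> homogeneous of degree
  \<open>-2\<close>, Euler's relation gives \<open>div (f x) = (n - 2) f\<close>.\<close>

lemma div_T:
  assumes "x \<noteq> 0"
  shows "(\<Sum>b\<in>Basis. T' x b \<bullet> b) = - (real CARD('n) - 2) * F x / (x \<bullet> x)"
proof -
  let ?r = "x \<bullet> x"
  have F': "(\<Sum>b\<in>Basis. F' x b * (x \<bullet> b)) = 0"
  proof -
    have lin: "linear (F' x)" using F_der[OF assms] by (rule has_derivative_linear)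
    have "F' x x = F' x (\<Sum>b\<in>Basis. (x \<bullet> b) *\<^sub>R b)" by (simp add: euclidean_representation)
    also have "\<dots> = (\<Sum>b\<in>Basis. F' x b * (x \<bullet> b))"
      by (simp add: linear_sum[OF lin] linear_scale[OF lin] mult.commute)
    finally show ?thesis using F'_radial[OF assms] by simp
  qed
  have "(\<Sum>b\<in>Basis. T' x b \<bullet> b) = (\<Sum>b\<in>Basis. u' x b \<bullet> b - (F x / ?r) * (b \<bullet> b)
      - (1 / ?r) * (F' x b * (x \<bullet> b)) + (2 * F x / ?r\<^sup>2) * ((x \<bullet> b) * (b \<bullet> x)))"
  proof (intro sum.cong refl)
    fix b :: "real ^ 'n"
    have "(F' x b * ?r - F x * (2 * (x \<bullet> b))) / ?r\<^sup>2 = (1 / ?r) * F' x b - (2 * F x / ?r\<^sup>2) * (x \<bullet> b)"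
      using assms by (simp add: diff_divide_distrib power2_eq_square)
    then show "T' x b \<bullet> b = u' x b \<bullet> b - (F x / ?r) * (b \<bullet> b)
      - (1 / ?r) * (F' x b * (x \<bullet> b)) + (2 * F x / ?r\<^sup>2) * ((x \<bullet> b) * (b \<bullet> x))"
      by (simp only: T'_def inner_diff_left inner_scaleR_left left_diff_distrib mult.assoc inner_commute[of b x])
  qed
  also have "\<dots> = - (F x / ?r) * real CARD('n) + 2 * F x / ?r\<^sup>2 * ?r"
    unfolding sum.distrib sum_subtractf sum_distrib_left[symmetric] F' div_u[OF assms]
      sum_Basis_inner_mult_inner
    by (simp add: inner_Basis)
  also have "\<dots> = - (real CARD('n) - 2) * F x / ?r"
    using assms by (simp add: field_simps power2_eq_square)
  finally show ?thesis .
qed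

text \<open>The divergence of \<open>\<eta> G T\<close>, for a radial cutoff \<open>\<eta>\<close>, is \<open>\<eta>\<close> times
  the expression below, because \<open>T\<close> is tangent to the spheres.\<close>

lemma divergence_test:
  assumes der: "\<And>x. x \<noteq> 0 \<Longrightarrow> (G has_derivative G' x) (at x)"
    and cont: "\<And>a. continuous_on (- {0}) (\<lambda>x. G' x a)"
    and nonneg: "\<And>x. x \<noteq> 0 \<Longrightarrow> 0 \<le> G' x (T x) - (real CARD('n) - 2) * F x / (x \<bullet> x) * G x"
    and "norm x = 1"
  shows "G' x (T x) - (real CARD('n) - 2) * F x / (x \<bullet> x) * G x = 0"
proof -
  obtain \<eta> c :: "real ^ 'n \<Rightarrow> real"
    where \<eta>: "\<And>x. (\<eta> has_derivative (\<lambda>a. c x * (x \<bullet> a))) (at x)" "continuous_on UNIV c"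
      "\<And>x. 0 \<le> \<eta> x" "\<And>x. norm x = 1 \<Longrightarrow> 0 < \<eta> x"
      "\<And>x. norm x \<le> 1 / 2 \<or> 2 \<le> norm x \<Longrightarrow> \<eta> x = 0 \<and> c x = 0"
    by (rule obtain_radial_cutoff) blast
  define W where "W x = (\<eta> x * G x) *\<^sub>R T x" for x
  define W' where "W' x a = (\<eta> x * G x) *\<^sub>R T' x a + (\<eta> x * G' x a + c x * (x \<bullet> a) * G x) *\<^sub>R T x" for x a
  \<comment> \<open>The cutoff vanishes near the origin, so \<open>W\<close> is zero there and
    differentiable across the singularity, whatever values \<open>G\<close> and \<open>T\<close>
    take.\<close>
  have near_0: "W x = 0" "W' x a = 0" if "x \<in> ball 0 (1 / 2)" for x a
    using \<eta>(5)[of x] that by (auto simp: W_def W'_def)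
  have W_der: "(W has_derivative W' x) (at x)" for x
  proof (cases "x = 0")
    case True
    have "W' x = (\<lambda>a. 0)" using near_0(2)[of x] True by (intro ext) simp
    then have "((\<lambda>x. 0) has_derivative W' x) (at x)" by simp
    then show ?thesis
      by (rule has_derivative_transform_within_open[where s="ball 0 (1 / 2)"]) (use True near_0 in auto)
  next
    case False
    show ?thesis unfolding W_def W'_def[abs_def]
      by (intro has_derivative_scaleR has_derivative_mult \<eta>(1) der T_der False)
  qed
  have \<eta>_cont: "continuous_on UNIV \<eta>"
    by (meson \<eta>(1) continuous_at_imp_continuous_on has_derivative_continuous)
  have G_cont: "continuous_on (- {0}) G"
    by (auto intro!: continuous_at_imp_continuous_on intro: der has_derivative_continuous)
  have W'_cont: "continuous_on UNIV (\<lambda>x. W' x a)" for a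
  proof -
    have "continuous_on (ball 0 (1 / 2)) (\<lambda>x. W' x a)"
      by (rule continuous_on_eq[OF continuous_on_const[of _ 0]]) (simp only: near_0(2))
    moreover have "continuous_on (- {0}) (\<lambda>x. W' x a)"
      unfolding W'_def
      by (intro continuous_on_add continuous_on_scaleR continuous_on_mult continuous_on_fields T'_cont cont G_cont
          continuous_on_inner continuous_on_id continuous_on_const
          continuous_on_subset[OF \<eta>_cont subset_UNIV] continuous_on_subset[OF \<eta>(2) subset_UNIV])
    ultimately have "continuous_on (ball 0 (1 / 2) \<union> - {0}) (\<lambda>x. W' x a)"
      by (intro continuous_on_open_Un) auto
    moreover have "ball 0 (1 / 2) \<union> - {0} = (UNIV :: (real ^ 'n) set)" by auto
    ultimately show ?thesis by simp
  qed
  have div: "(\<Sum>b\<in>Basis. W' x b \<bullet> b)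
      = \<eta> x * (G' x (T x) - (real CARD('n) - 2) * F x / (x \<bullet> x) * G x)" if "x \<noteq> 0" for x
  proof -
    have lin: "linear (G' x)" using der[OF that] by (rule has_derivative_linear)
    have "G' x (T x) = G' x (\<Sum>b\<in>Basis. (T x \<bullet> b) *\<^sub>R b)" by (simp add: euclidean_representation)
    also have "\<dots> = (\<Sum>b\<in>Basis. G' x b * (T x \<bullet> b))"
      by (simp add: linear_sum[OF lin] linear_scale[OF lin] mult.commute)
    finally have G': "(\<Sum>b\<in>Basis. G' x b * (T x \<bullet> b)) = G' x (T x)" ..
    \<comment> \<open>The last summand comes from the gradient of the cutoff; it sums to a multiple
      of \<open>x \<bullet> T x\<close>, which is zero.\<close>
    have "(\<Sum>b\<in>Basis. W' x b \<bullet> b) = (\<Sum>b\<in>Basis. \<eta> x * G x * (T' x b \<bullet> b)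
        + \<eta> x * (G' x b * (T x \<bullet> b)) + c x * G x * ((x \<bullet> b) * (b \<bullet> T x)))"
      by (intro sum.cong refl) (simp add: W'_def inner_add_left inner_commute algebra_simps)
    also have "\<dots> = \<eta> x * (G' x (T x) - (real CARD('n) - 2) * F x / (x \<bullet> x) * G x)"
      unfolding sum.distrib sum_distrib_left[symmetric] G' div_T[OF that] sum_Basis_inner_mult_inner inner_T
      by (simp add: algebra_simps add_divide_distrib[symmetric])
    finally show ?thesis .
  qed
  have "(\<Sum>b\<in>Basis. W' x b \<bullet> b) = 0"
  proof (rule divergence_nonneg_imp_eq_0[OF W_der W'_cont])
    show "compact (cball (0 :: real ^ 'n) 2)" by simp
    show "W x = 0" if "x \<notin> cball 0 2" for x
      using \<eta>(5)[of x] that by (auto simp: W_def)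
    show "0 \<le> (\<Sum>b\<in>Basis. W' x b \<bullet> b)" for x
      using near_0(2)[of x] nonneg[of x] \<eta>(3)[of x] by (cases "x = 0") (auto simp: div)
  qed
  moreover have "x \<noteq> 0" using \<open>norm x = 1\<close> by auto
  ultimately show ?thesis using \<eta>(4)[OF \<open>norm x = 1\<close>] by (simp add: div)
qed

section \<open>Vanishing of the Bernoulli function and of the radial component\<close>

lemma bernoulli_eq_0:
  assumes "x \<noteq> 0" shows "P x = 0"
proof -
  \<comment> \<open>Since \<open>n \<ge> 4\<close>, the subtraction on naturals is exact; the
    exponent \<open>k / 2\<close> is nonnegative, which keeps \<open>g\<close> continuously
    differentiable at \<open>0\<close>, a value that \<open>P\<close> may take.\<close>
  define k where "k = CARD('n) - 4"
  have k: "real (k + 2) = real CARD('n) - 2" using dim by (simp add: k_def)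
  \<comment> \<open>This exponent makes \<open>t g'(t) = (n - 2) / 2 g(t)\<close>, so that the terms with \<open>F\<^sup>2\<close> in \<open>G'_T\<close> cancel.\<close>
  define g where "g t = t * sqrt \<bar>t\<bar> ^ k" for t
  define g' where "g' t = real (k + 2) / 2 * sqrt \<bar>t\<bar> ^ k" for t
  have g: "(g has_real_derivative g' t) (at t)" for t
    unfolding g_def g'_def by (rule has_real_derivative_mult_sqrt_abs_power)
  define G where "G x = F x * g (P x)" for x
  define G' where "G' x a = F x * (g' (P x) * P' x a) + F' x a * g (P x)" for x a
  have G'_T: "G' x (T x) - (real CARD('n) - 2) * F x / (x \<bullet> x) * G x = 2 * (P x * g (P x))"
    if "x \<noteq> 0" for x
  proof -
    have "g' (P x) * P x = real (k + 2) / 2 * g (P x)"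
      by (simp only: g_def g'_def mult_ac)
    then have "F x * (g' (P x) * P' x (T x)) = real (k + 2) * F x / (x \<bullet> x) * (F x * g (P x))"
      by (simp add: P'_T that)
    then show ?thesis by (simp add: G'_def G_def F'_T that k[symmetric])
  qed
  \<comment> \<open>In this form the product is visibly nonnegative and zero only at
    \<open>t = 0\<close>, also when \<open>k = 0\<close>.\<close>
  have g_pos: "t * g t = t\<^sup>2 * sqrt \<bar>t\<bar> ^ k" for t
    by (simp add: g_def power2_eq_square)
  \<comment> \<open>The divergence test concludes at unit vectors; homogeneity of \<open>P\<close>
    carries the result back to \<open>x\<close>.\<close>
  define y where "y = x /\<^sub>R norm x"
  have y: "norm y = 1" "y \<noteq> 0" using assms by (auto simp: y_def)
  have "G' y (T y) - (real CARD('n) - 2) * F y / (y \<bullet> y) * G y = 0"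
  proof (rule divergence_test)
    fix x :: "real ^ 'n" assume x: "x \<noteq> 0"
    have "((\<lambda>x. g (P x)) has_derivative (\<lambda>a. g' (P x) * P' x a)) (at x)"
      by (rule has_derivative_compose[OF P_der[OF x] g[unfolded has_field_derivative_def]])
    then show "(G has_derivative G' x) (at x)"
      unfolding G_def G'_def[abs_def] by (intro has_derivative_mult F_der x)
    show "0 \<le> G' x (T x) - (real CARD('n) - 2) * F x / (x \<bullet> x) * G x"
      unfolding G'_T[OF x] g_pos by simp
  next
    show "continuous_on (- {0}) (\<lambda>x. G' x a)" for a
      unfolding G'_def g_def g'_def by (intro continuous_intros continuous_on_fields P'_cont F'_cont)
  qed fact
  then have "P y = 0" unfolding G'_T[OF y(2)] g_pos by auto
  moreover have "P y = P x / (inverse (norm x))\<^sup>2"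
    unfolding y_def using assms by (intro P_homogeneous) auto
  ultimately show ?thesis using assms by simp
qed

text \<open>Once \<open>P = 0\<close>, \<open>F\<close> has zero derivative along \<open>T\<close>,
  so only the divergence of \<open>T\<close> enters the test. The choice \<open>G = - F\<close>
  makes the outcome a nonnegative multiple of \<open>F^2\<close>.\<close>

lemma radial_component_eq_0:
  assumes "x \<noteq> 0" shows "x \<bullet> u x = 0"
proof -
  define y where "y = x /\<^sub>R norm x"
  have y: "norm y = 1" "y \<noteq> 0" using assms by (auto simp: y_def)
  have val: "- F' x (T x) - (real CARD('n) - 2) * F x / (x \<bullet> x) * (- F x)
      = (real CARD('n) - 2) * (F x)\<^sup>2 / (x \<bullet> x)" if "x \<noteq> 0" for x
    using that by (simp add: F'_T bernoulli_eq_0 power2_eq_square)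
  have "- F' y (T y) - (real CARD('n) - 2) * F y / (y \<bullet> y) * (- F y) = 0"
  proof (rule divergence_test[where G="\<lambda>x. - F x" and G'="\<lambda>x a. - F' x a"])
    show "((\<lambda>x. - F x) has_derivative (\<lambda>a. - F' x a)) (at x)" if "x \<noteq> 0" for x
      by (intro derivative_intros F_der that)
    show "0 \<le> - F' x (T x) - (real CARD('n) - 2) * F x / (x \<bullet> x) * (- F x)" if "x \<noteq> 0" for x
      unfolding val[OF that] using dim by simp
    show "continuous_on (- {0}) (\<lambda>x. - F' x a)" for a by (intro continuous_intros F'_cont)
  qed fact
  then have "F y = 0" unfolding val[OF y(2)] using dim y by simp
  moreover have "F y = F x" unfolding y_def using assms by (intro F_homogeneous) auto
  ultimately show ?thesis by (simp add: F_def)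
qed

lemma contract_d_u_eq_0: "x \<noteq> 0 \<Longrightarrow> u' x (u x) \<bullet> a - u' x a \<bullet> u x = 0"
proof -
  assume x: "x \<noteq> 0"
  have "((\<lambda>x. 0) has_derivative (\<lambda>a. 0)) (at x)" by simp
  then have "(P has_derivative (\<lambda>a. 0)) (at x)"
    by (rule has_derivative_transform_within_open[where s="- {0}"]) (use x bernoulli_eq_0 in auto)
  from has_derivative_unique[OF P_der[OF x] this] euler[OF x, of a] show ?thesis by simp
qed

lemma geodesible_u: "geodesible u"
  using sol contract_d_u_eq_0
  by (auto simp: geodesible_def contract_def d_form_flat[OF u_der] homogeneous_solution_def steady_euler_def)

end

section \<open>Two-forms annihilated by two vectors in dimension four\<close>

text \<open>As \<open>e\<close> is a bijection, position \<open>k\<close> of the list occupies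
  exactly one row of the matrix. This yields the linearity of \<open>vol4\<close> in its
  arguments.\<close>

lemma linear_det_row_update:
  fixes e :: "'n::finite \<Rightarrow> nat" and xs :: "(real ^ 'n) list"
  assumes e: "bij_betw e UNIV {..<length xs}" and k: "k < length xs"
  shows "linear (\<lambda>a. det (\<chi> i. xs[k := a] ! e i))"
proof -
  obtain j where j: "e j = k" using e k by (metis bij_betw_iff_bijections lessThan_iff)
  have inj: "e i = k \<longleftrightarrow> i = j" for i using e j by (metis bij_betw_def injD)
  have less: "e i < length xs" for i using e by (auto simp: bij_betw_def)
  have rows: "(\<chi> i. xs[k := a] ! e i) = (\<chi> i. if i = j then a else xs ! e i)" for a
    by (simp add: vec_eq_iff nth_list_update k eq_commute[of k] inj)
  show ?thesis
  proof (rule linearI)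
    show "det (\<chi> i. xs[k := a + b] ! e i) = det (\<chi> i. xs[k := a] ! e i) + det (\<chi> i. xs[k := b] ! e i)" for a b
      unfolding rows by (rule det_row_add)
    show "det (\<chi> i. xs[k := r *\<^sub>R a] ! e i) = r *\<^sub>R det (\<chi> i. xs[k := a] ! e i)" for r a
      unfolding rows using det_row_mul[of j r "\<lambda>_. a" "\<lambda>i. xs ! e i"]
      by (simp only: scalar_mult_eq_scaleR real_scaleR_def)
  qed
qed

context
  fixes e :: "'n::finite \<Rightarrow> nat"
  assumes e: "bij_betw e UNIV {..<4}"
begin

lemma linear_vol4:
  "linear (\<lambda>z. vol4 e x z a b)" "linear (\<lambda>z. vol4 e x y z b)" "linear (\<lambda>z. vol4 e x y a z)"
proof -
  have e': "bij_betw e UNIV {..<length [x, y, a, b]}" using e by (simp add: eval_nat_numeral)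
  show "linear (\<lambda>z. vol4 e x z a b)" "linear (\<lambda>z. vol4 e x y z b)" "linear (\<lambda>z. vol4 e x y a z)"
    using linear_det_row_update[OF e', of 1] linear_det_row_update[OF e', of 2]
      linear_det_row_update[OF e', of 3]
    by (simp_all add: vol4_def eval_nat_numeral)
qed

lemma obtain_index:
  assumes "k < 4" obtains i where "e i = k"
  using e assms by (metis bij_betw_iff_bijections lessThan_iff)

lemma vol4_eq_0:
  assumes "k < 4" "l < 4" "k \<noteq> l" "[x, y, a, b] ! k = [x, y, a, b] ! l"
  shows "vol4 e x y a b = 0"
proof -
  obtain i j where ij: "e i = k" "e j = l" using obtain_index assms by metis
  show ?thesis unfolding vol4_def
    by (rule det_identical_rows[of i j]) (use ij assms in \<open>auto simp: row_def\<close>)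
qed

lemma vol4_nonzero:
  assumes "span {x, y, a, b} = UNIV" shows "vol4 e x y a b \<noteq> 0"
proof -
  let ?A = "\<chi> i. [x, y, a, b] ! e i"
  have "rows ?A = (\<lambda>i. [x, y, a, b] ! e i) ` UNIV"
    by (auto simp: rows_def row_def vec_lambda_eta)
  also have "\<dots> = (!) [x, y, a, b] ` {..<4}"
    using e by (metis bij_betw_imp_surj_on image_image)
  also have "\<dots> = {x, y, a, b}"
    by (auto simp: eval_nat_numeral lessThan_Suc)
  finally have "span (rows ?A) = UNIV" using assms by simp
  then have "invertible ?A"
    unfolding invertible_left_inverse matrix_left_invertible_span_rows .
  then show ?thesis unfolding vol4_def invertible_det_nz .
qed

text \<open>Extend \<open>x\<close>, \<open>y\<close> to a basis by \<open>c\<close>,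
  \<open>d\<close>. Both forms vanish as soon as one argument is \<open>x\<close> or
  \<open>y\<close>, so each is determined by its value at \<open>(c, d)\<close>; the volume is
  nonzero there, and \<open>l\<close> is the quotient.\<close>

lemma alternating_form_eq_mult_vol4:
  assumes \<omega>: "bilinear \<omega>" and alt: "\<And>a. \<omega> a a = 0"
    and ker: "\<And>b. \<omega> x b = 0" "\<And>b. \<omega> y b = 0"
    and ind: "independent {x, y}" "x \<noteq> y"
  shows "\<exists>l. \<forall>a b. l * vol4 e x y a b = \<omega> a b"
proof -
  have antisym: "\<theta> a b = - \<theta> b a" if "bilinear \<theta>" "\<And>a. \<theta> a a = (0::real)" for \<theta> and a b :: "real ^ 'n"
  proof -
    have "\<theta> (a + b) (a + b) = \<theta> a a + \<theta> b a + (\<theta> a b + \<theta> b b)"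
      by (simp only: bilinear_ladd[OF that(1)] bilinear_radd[OF that(1)])
    then show ?thesis by (simp add: that(2))
  qed
  have "CARD('n) = 4" using bij_betw_same_card[OF e] by simp
  obtain B where B: "{x, y} \<subseteq> B" "independent B" "UNIV \<subseteq> span B"
    using maximal_independent_subset_extend[OF subset_UNIV ind(1)] by metis
  then have span: "span B = UNIV" by blast
  have "finite B" using B(2) by (rule independent_imp_finite)
  moreover have "card B = 4"
    using dim_span_eq_card_independent[OF B(2)] \<open>CARD('n) = 4\<close> by (simp add: span)
  ultimately have "card (B - {x, y}) = 2" using B(1) ind(2) by (simp add: card_Diff_subset)
  then obtain c d where cd: "B - {x, y} = {c, d}" "c \<noteq> d" by (auto simp: card_2_iff)
  with B(1) have B_eq: "B = {x, y, c, d}" by auto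
  define V where "V = vol4 e x y"
  have V: "bilinear V" unfolding V_def bilinear_def using linear_vol4 by auto
  have V_alt: "V a a = 0" for a unfolding V_def by (rule vol4_eq_0[of 2 3]) auto
  have V_ker: "V x b = 0" "V y b = 0" for b
    unfolding V_def by (rule vol4_eq_0[of 0 2], auto) (rule vol4_eq_0[of 1 2], auto)
  have V_ker': "V b x = 0" "V b y = 0" and ker': "\<omega> b x = 0" "\<omega> b y = 0" for b
    using antisym[OF V V_alt, of b] antisym[OF \<omega> alt, of b] V_ker ker by simp_all
  have nz: "V c d \<noteq> 0" using vol4_nonzero span unfolding V_def B_eq .
  define l where "l = \<omega> c d / V c d"
  have lcd: "l * V c d = \<omega> c d" using nz by (simp add: l_def)
  then have ldc: "l * V d c = \<omega> d c"
    using antisym[OF V V_alt, of d c] antisym[OF \<omega> alt, of d c] by simp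
  have lV: "bilinear (\<lambda>a b. l * V a b)"
    using V by (auto simp: bilinear_def intro: linear_compose_scale_right[where 'a="real ^ 'n" and 'b=real, simplified])
  have "l * V a b = \<omega> a b" for a b
  proof (rule bilinear_eq[OF lV \<omega>, of UNIV B UNIV B])
    show "UNIV \<subseteq> span B" "UNIV \<subseteq> span B" using span by auto
    show "l * V s t = \<omega> s t" if "s \<in> B" "t \<in> B" for s t
      using that unfolding B_eq by (auto simp: V_ker V_ker' ker ker' V_alt alt lcd ldc)
  qed auto
  then show ?thesis unfolding V_def by blast
qed

end

section \<open>The field on the sphere\<close>

text \<open>At a zero \<open>y\<close> of \<open>u\<close> with derivative \<open>A\<close>, dividing \<open>du(u, b) = 0\<close> at \<open>y + t a\<close> by \<open>t\<close> and letting
  \<open>t\<close> tend to \<open>0\<close> gives \<open>du(A a, b) = 0\<close>. The squared Hilbert-Schmidt norm of \<open>du\<close> at \<open>y\<close> is a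
  combination of such terms.\<close>

lemma exterior_derivative_eq_0_at_zero:
  fixes u :: "'a::euclidean_space \<Rightarrow> 'a"
  assumes S: "open S" "y \<in> S"
    and der: "\<And>x. x \<in> S \<Longrightarrow> (u has_derivative u' x) (at x)"
    and cont: "\<And>a. continuous_on S (\<lambda>x. u' x a)"
    and contr: "\<And>x a. x \<in> S \<Longrightarrow> u' x (u x) \<bullet> a = u' x a \<bullet> u x"
    and "u y = 0"
  shows "u' y a \<bullet> b = u' y b \<bullet> a"
proof -
  let ?\<omega> = "\<lambda>x a b. u' x a \<bullet> b - u' x b \<bullet> a"
  have expand: "?\<omega> x w b = (\<Sum>i\<in>Basis. (w \<bullet> i) * ?\<omega> x i b)" if "x \<in> S" for x w b
  proof -
    have lin: "linear (\<lambda>w. ?\<omega> x w b)"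
      using has_derivative_linear[OF der[OF that]]
      by (intro linear_compose_sub linearI) (auto simp: linear_add linear_scale inner_simps)
    have "?\<omega> x w b = (\<lambda>w. ?\<omega> x w b) (\<Sum>i\<in>Basis. (w \<bullet> i) *\<^sub>R i)" by (simp add: euclidean_representation)
    also have "\<dots> = (\<Sum>i\<in>Basis. (w \<bullet> i) * ?\<omega> x i b)"
      by (simp only: linear_sum[OF lin] linear_scale[OF lin] real_scaleR_def)
    finally show ?thesis .
  qed
  \<comment> \<open>The sum is \<open>du(A a, b)\<close> expanded in the coordinates of
    \<open>A a\<close>, with \<open>A = u' y\<close>.\<close>
  have key: "(\<Sum>i\<in>Basis. (u' y a \<bullet> i) * ?\<omega> y i b) = 0" for a b
  proof -
    define z where "z t = y + t *\<^sub>R a" for t :: real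
    have z: "z 0 = y" by (simp add: z_def)
    have "isCont z 0" unfolding z_def[abs_def] by (intro continuous_intros)
    then have z_lim: "(z \<longlongrightarrow> y) (at 0)" using z by (simp add: isCont_def)
    have quot: "((\<lambda>t. (u (z t) /\<^sub>R t) \<bullet> i) \<longlongrightarrow> u' y a \<bullet> i) (at 0)" for i
    proof -
      have "(z has_derivative (\<lambda>t. t *\<^sub>R a)) (at 0)"
        unfolding z_def[abs_def] by (auto intro!: derivative_eq_intros)
      moreover have "(u has_derivative u' y) (at (z 0))" using der[OF S(2)] z by simp
      ultimately have "((\<lambda>t. u (z t)) has_derivative (\<lambda>t. u' y (t *\<^sub>R a))) (at 0)"
        by (rule has_derivative_compose)
      from has_derivative_inner_left[OF this, of i]
      have "((\<lambda>t. u (z t) \<bullet> i) has_real_derivative u' y a \<bullet> i) (at 0)"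
        using has_derivative_linear[OF der[OF S(2)]]
        by (simp add: has_field_derivative_def linear_scale mult_commute_abs)
      then show ?thesis
        by (simp add: has_field_derivative_iff z \<open>u y = 0\<close> divide_inverse mult.commute)
    qed
    have \<omega>_lim: "((\<lambda>t. ?\<omega> (z t) i b) \<longlongrightarrow> ?\<omega> y i b) (at 0)" for i
    proof -
      have "isCont (\<lambda>x. u' x c) y" for c using cont S continuous_on_eq_continuous_at by blast
      then have "((\<lambda>t. u' (z t) c) \<longlongrightarrow> u' y c) (at 0)" for c
        using z_lim isCont_tendsto_compose by blast
      then show ?thesis by (intro tendsto_intros)
    qed
    have "((\<lambda>t. \<Sum>i\<in>Basis. ((u (z t) /\<^sub>R t) \<bullet> i) * ?\<omega> (z t) i b) \<longlongrightarrow>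
        (\<Sum>i\<in>Basis. (u' y a \<bullet> i) * ?\<omega> y i b)) (at 0)"
      by (intro tendsto_sum tendsto_mult quot \<omega>_lim)
    moreover have "\<forall>\<^sub>F t in at 0. (\<Sum>i\<in>Basis. ((u (z t) /\<^sub>R t) \<bullet> i) * ?\<omega> (z t) i b) = 0"
      using topological_tendstoD[OF z_lim S]
    proof (rule eventually_mono)
      fix t assume t: "z t \<in> S"
      have "(\<Sum>i\<in>Basis. ((u (z t) /\<^sub>R t) \<bullet> i) * ?\<omega> (z t) i b) = ?\<omega> (z t) (u (z t) /\<^sub>R t) b"
        by (rule expand[OF t, symmetric])
      also have "\<dots> = ?\<omega> (z t) (u (z t)) b / t"
        using has_derivative_linear[OF der[OF t]] by (simp add: linear_scale divide_inverse algebra_simps)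
      finally show "(\<Sum>i\<in>Basis. ((u (z t) /\<^sub>R t) \<bullet> i) * ?\<omega> (z t) i b) = 0"
        using contr[OF t] by simp
    qed
    ultimately show ?thesis
      using tendsto_unique[OF at_neq_bot _ tendsto_eventually] by blast
  qed
  \<comment> \<open>With \<open>A_ij = u' y i \<bullet> j\<close>, antisymmetry gives
    \<open>\<omega>_ij^2 = - A_ij \<omega>_ji - A_ji \<omega>_ij\<close>. Summed over
    \<open>j\<close> and over \<open>i\<close> respectively, the two products are instances of
    \<open>key\<close> with \<open>a = b\<close>.\<close>
  have "(\<Sum>i\<in>Basis. \<Sum>j\<in>Basis. (?\<omega> y i j)\<^sup>2)
      = (\<Sum>i\<in>Basis. \<Sum>j\<in>Basis. - ((u' y i \<bullet> j) * ?\<omega> y j i) - (u' y j \<bullet> i) * ?\<omega> y i j)"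
    by (simp add: power2_eq_square algebra_simps)
  also have "\<dots> = - (\<Sum>i\<in>Basis. \<Sum>j\<in>Basis. (u' y i \<bullet> j) * ?\<omega> y j i)
      - (\<Sum>j\<in>Basis. \<Sum>i\<in>Basis. (u' y j \<bullet> i) * ?\<omega> y i j)"
    by (subst (2) sum.swap) (simp only: sum_subtractf sum_negf)
  also have "\<dots> = 0" by (simp only: key) simp
  finally have "(\<Sum>i\<in>Basis. \<Sum>j\<in>Basis. (?\<omega> y i j)\<^sup>2) = 0" .
  then have "\<forall>i\<in>Basis. (\<Sum>j\<in>Basis. (?\<omega> y i j)\<^sup>2) = 0"
    by (subst (asm) sum_nonneg_eq_0_iff) (auto intro: sum_nonneg)
  then have basis: "?\<omega> y i j = 0" if "i \<in> Basis" "j \<in> Basis" for i j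
    using that by (auto simp: sum_nonneg_eq_0_iff)
  have row: "?\<omega> y i b = 0" if "i \<in> Basis" for i b
    using expand[OF S(2), of b i] basis[OF _ that] by (simp add: algebra_simps)
  have "?\<omega> y a b = 0"
    unfolding expand[OF S(2), of a b] by (intro sum.neutral ballI) (simp only: row mult_zero_right)
  then show ?thesis by simp
qed

text \<open>With \<open>Q\<close> the orthogonal projection off \<open>y\<close>,
  \<open>tr (Q A Q) = tr (A Q)\<close>, and removing the normal direction takes the entry
  \<open>A y \<bullet> y\<close> from the trace.\<close>

lemma trace_tangent_proj_conjugate:
  fixes y :: "real ^ 'n"
  assumes A: "linear A" and y: "norm y = 1"
  shows "trace (matrix (\<lambda>a. tangent_proj y (A (tangent_proj y a)))) = (\<Sum>b\<in>Basis. A b \<bullet> b) - A y \<bullet> y"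
proof -
  have yy: "y \<bullet> y = 1" using y by (simp add: dot_square_norm)
  have Ay: "(\<Sum>b\<in>Basis. (y \<bullet> b) * (A b \<bullet> y)) = A y \<bullet> y"
  proof -
    have "A y = A (\<Sum>b\<in>Basis. (y \<bullet> b) *\<^sub>R b)" by (simp only: euclidean_representation)
    also have "\<dots> = (\<Sum>b\<in>Basis. (y \<bullet> b) *\<^sub>R A b)"
      by (simp only: linear_sum[OF A] linear_scale[OF A])
    finally show ?thesis by (simp only: inner_sum_left inner_scaleR_left)
  qed
  have "tangent_proj y (A (tangent_proj y b)) \<bullet> b
      = A b \<bullet> b - (y \<bullet> b) * (b \<bullet> A y) - (y \<bullet> b) * (A b \<bullet> y) + (A y \<bullet> y) * ((y \<bullet> b) * (b \<bullet> y))" for b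
    by (simp add: tangent_proj_def linear_diff[OF A] linear_scale[OF A] inner_diff_left inner_diff_right
        inner_commute algebra_simps)
  then show ?thesis
    by (simp only: trace_matrix sum.distrib sum_subtractf sum_distrib_left[symmetric]
        sum_Basis_inner_mult_inner Ay yy) (simp add: inner_commute)
qed

section \<open>Intrinsic derivatives of \<open>u\<close> on the sphere\<close>

context homogeneous_euler
begin

text \<open>Up to sign, \<open>F'\<close> is the contraction of \<open>du\<close> with
  \<open>x\<close>; its vanishing makes \<open>x\<close> the first of the two vectors annihilating
  \<open>du\<close> in dimension four.\<close>

lemma F'_eq_0: "x \<noteq> 0 \<Longrightarrow> F' x a = 0"
proof -
  assume x: "x \<noteq> 0"
  have "((\<lambda>x. 0) has_derivative (\<lambda>a. 0)) (at x)" by simp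
  then have "(F has_derivative (\<lambda>a. 0)) (at x)"
    by (rule has_derivative_transform_within_open[where s="- {0}"])
      (use x radial_component_eq_0 in \<open>auto simp: F_def\<close>)
  from has_derivative_unique[OF F_der[OF x] this] show ?thesis by simp
qed

lemma tangential_u: "tangential u"
  unfolding tangential_def
proof
  fix y :: "real ^ 'n" assume "y \<in> sphere 0 1"
  then have "y \<noteq> 0" by auto
  then show "u y \<bullet> y = 0" by (simp add: radial_component_eq_0 inner_commute[of _ y])
qed

lemma has_derivative_u_radial_proj:
  assumes "y \<in> sphere 0 1"
  shows "(u \<circ> radial_proj has_derivative (\<lambda>a. u' y (tangent_proj y a))) (at y)"
proof -
  have y: "norm y = 1" "y \<noteq> 0" "radial_proj y = y" using assms by (auto simp: radial_proj_def)
  have r: "(radial_proj has_derivative tangent_proj y) (at y)"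
    using radial_proj_has_derivative[OF y(2)] y by simp
  have "(u has_derivative u' y) (at (radial_proj y))" using u_der y by simp
  from has_derivative_compose[OF r this] show ?thesis by (simp add: o_def)
qed

lemma sphere_cov_u:
  "y \<in> sphere 0 1 \<Longrightarrow> sphere_cov u y a = tangent_proj y (u' y (tangent_proj y a))"
  by (simp add: sphere_cov_def frechet_derivative_at[OF has_derivative_u_radial_proj, symmetric])

text \<open>On tangent vectors both projections in \<open>sphere_cov\<close> drop out: the inner one
  fixes its argument, and the outer one removes a part orthogonal to the other argument.\<close>

lemma sphere_d_u:
  assumes "y \<in> sphere 0 1" "a \<bullet> y = 0" "b \<bullet> y = 0"
  shows "sphere_d (flat u) y a b = u' y a \<bullet> b - u' y b \<bullet> a"
proof -
  have "(u \<circ> radial_proj) differentiable (at y)"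
    using has_derivative_u_radial_proj[OF assms(1)] by (auto simp: differentiable_def)
  from sphere_d_flat[OF assms this] show ?thesis
    using assms by (simp add: sphere_cov_u tangent_proj_def inner_diff_left inner_commute[of y])
qed

text \<open>The trace on the tangent space is the flat divergence minus the normal entry
  \<open>u' y y \<bullet> y = - u y \<bullet> y\<close>, and both vanish.\<close>

lemma sphere_div_u:
  assumes "y \<in> sphere 0 1" shows "sphere_div u y = 0"
proof -
  have y: "norm y = 1" "y \<noteq> 0" "y \<bullet> y = 1" using assms by (auto simp: dot_square_norm)
  have "tangent_proj y (tangent_proj y a) = tangent_proj y a" for a
    using y by (simp add: tangent_proj_def inner_diff_right)
  then have "sphere_div u y = trace (matrix (\<lambda>a. tangent_proj y (u' y (tangent_proj y a))))"
    using assms by (simp add: sphere_div_def sphere_cov_u)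
  also have "\<dots> = 0"
    using trace_tangent_proj_conjugate[OF has_derivative_linear[OF u_der[OF y(2)]] y(1)]
    by (simp add: div_u u'_radial radial_component_eq_0 inner_commute[of _ y] y)
  finally show ?thesis .
qed

lemma sphere_geodesible_u: "sphere_geodesible u"
  unfolding sphere_geodesible_def contract_def
proof (intro ballI conjI allI impI)
  fix y a :: "real ^ 'n" assume y: "y \<in> sphere 0 1" and a: "a \<bullet> y = 0"
  have "y \<noteq> 0" using y by auto
  moreover have "u y \<bullet> y = 0" using tangential_u y by (auto simp: tangential_def)
  ultimately show "sphere_d (flat u) y (u y) a = 0"
    using y a contract_d_u_eq_0[of y a] by (simp add: sphere_d_u)
qed (rule sphere_div_u)

lemma sphere_beltrami_u:
  fixes e :: "'n \<Rightarrow> nat"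
  assumes e: "bij_betw e UNIV {..<4}"
  shows "sphere_beltrami e u"
proof -
  have "\<exists>l. \<forall>a b. l * vol4 e y (u y) a b = u' y a \<bullet> b - u' y b \<bullet> a" if y: "y \<in> sphere 0 1" for y
  proof (cases "u y = 0")
    case True
    have "u' y a \<bullet> b = u' y b \<bullet> a" for a b
      by (rule exterior_derivative_eq_0_at_zero[where S="- {0}" and u=u and u'=u'])
        (use y True u_der u'_cont contract_d_u_eq_0 in auto)
    \<comment> \<open>At a zero of \<open>u\<close> the whole two-form vanishes, so the multiplier
      \<open>0\<close> serves.\<close>
    then show ?thesis by (intro exI[of _ 0]) simp
  next
    case False
    have y0: "y \<noteq> 0" using y by auto
    have yu: "y \<bullet> u y = 0" by (rule radial_component_eq_0[OF y0])
    show ?thesis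
    proof (rule alternating_form_eq_mult_vol4[OF e])
      show "bilinear (\<lambda>a b. u' y a \<bullet> b - u' y b \<bullet> a)"
        using has_derivative_linear[OF u_der[OF y0]]
        by (auto simp: bilinear_def linear_add linear_scale inner_simps algebra_simps intro!: linearI)
      show "u' y y \<bullet> b - u' y b \<bullet> y = 0" for b
        using F'_eq_0[OF y0, of b] by (simp add: F'_def u'_radial[OF y0] inner_commute)
      show "u' y (u y) \<bullet> b - u' y b \<bullet> u y = 0" for b by (rule contract_d_u_eq_0[OF y0])
      show "y \<noteq> u y" using yu y0 by auto
      have "pairwise orthogonal {y, u y}"
        using yu by (auto simp: pairwise_def orthogonal_def inner_commute)
      then show "independent {y, u y}"
        by (rule pairwise_orthogonal_independent) (use y0 False in auto)
    qed simp
  qed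
  then obtain l where l: "l y * vol4 e y (u y) a b = u' y a \<bullet> b - u' y b \<bullet> a" if "y \<in> sphere 0 1" for y a b
    by metis
  \<comment> \<open>The multipliers were chosen point by point. Linearity of \<open>vol4\<close> in
    its second argument moves \<open>l y\<close> into the field, so \<open>l u\<close> satisfies the
    equation that defines the curl.\<close>
  have "is_sphere_curl e u (\<lambda>y. l y *\<^sub>R u y)"
    using tangential_u linear_scale[OF linear_vol4(1)[OF e]]
    by (auto simp: is_sphere_curl_def tangential_def contract_def sphere_vol_def sphere_d_u l)
  then show ?thesis unfolding sphere_beltrami_def using sphere_div_u by blast
qed

end

theorem theorem1p1:
  fixes u :: "real ^ 'n \<Rightarrow> real ^ 'n" and p :: "real ^ 'n \<Rightarrow> real"
  assumes "CARD('n) \<ge> 4"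
    and "C1_on (- {0}) u" and "C1_on (- {0}) p"
    and "homogeneous_solution 1 u p"
  shows "geodesible u \<and>
    (\<forall>x. x \<noteq> 0 \<longrightarrow> bernoulli u p x = 0) \<and>
    (\<exists>v :: real ^ 'n \<Rightarrow> real ^ 'n.
      C1_on_sphere v \<and> tangential v \<and>
      (\<forall>x. x \<noteq> 0 \<longrightarrow>
        u x = (1 / norm x) *\<^sub>R v (x /\<^sub>R norm x) \<and>
        p x = - (1 / (2 * (norm x)\<^sup>2)) * (norm (v (x /\<^sub>R norm x)))\<^sup>2) \<and>
      sphere_geodesible v \<and>
      (CARD('n) = 4 \<longrightarrow>
        (\<forall>e :: 'n \<Rightarrow> nat. bij_betw e UNIV {..<4} \<longrightarrow> sphere_beltrami e v)))"
proof -
  obtain u' where u': "\<forall>x\<in>- {0}. (u has_derivative blinfun_apply (u' x)) (at x)" "continuous_on (- {0}) u'"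
    using assms(2) unfolding C1_on_def by blast
  obtain p' where p': "\<forall>x\<in>- {0}. (p has_derivative blinfun_apply (p' x)) (at x)" "continuous_on (- {0}) p'"
    using assms(3) unfolding C1_on_def by blast
  interpret homogeneous_euler u p "\<lambda>x. blinfun_apply (u' x)" "\<lambda>x. blinfun_apply (p' x)"
    using assms(1,4) u' p' by unfold_locales (auto intro!: continuous_intros)
  \<comment> \<open>The witness for \<open>v\<close> is \<open>u\<close> itself, which agrees with
    the rescaled field on the sphere and is its own extension to a neighbourhood.\<close>
  have "C1_on_sphere u"
    unfolding C1_on_sphere_def using assms(2) by (intro exI[of _ "- {0}"] exI[of _ u]) auto
  moreover have "u x = (1 / norm x) *\<^sub>R u (x /\<^sub>R norm x) \<and>
      p x = - (1 / (2 * (norm x)\<^sup>2)) * (norm (u (x /\<^sub>R norm x)))\<^sup>2" if "x \<noteq> 0" for x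
  proof -
    \<comment> \<open>Homogeneity with the factor \<open>1 / |x|\<close> moves the point to the
      sphere; \<open>P = 0\<close> then expresses \<open>p\<close> through
      \<open>|u|^2\<close>.\<close>
    have ux: "u (x /\<^sub>R norm x) = norm x *\<^sub>R u x"
      using homogeneous(1)[of "inverse (norm x)" x] that by (simp add: divide_inverse)
    moreover have "p x = - (norm (u x))\<^sup>2 / 2"
      using bernoulli_eq_0[OF that] by (simp add: bernoulli_def)
    ultimately show ?thesis using that by (simp add: power_mult_distrib)
  qed
  ultimately show ?thesis
    using geodesible_u bernoulli_eq_0 tangential_u sphere_geodesible_u sphere_beltrami_u by blast
qed

end
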